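(* Let $E$ be a Banach lattice. Then the following statements are equivalent: (1) $E$ has the disjoint weak$^{\star}$ Dunford-Pettis property. (2) Every operator $T:E\to E$ is disjoint weak$^{\star}$ Dunford-Pettis. (3) The identity operator of $E$ is disjoint weak$^{\star}$ Dunford-Pettis. (4) For every norm bounded disjoint sequence $(x_n)$ in $E$, the subset $\{x_n : n\in\mathbb{N}\}$ of $E$ is limited.
   Context: "Operator" means bounded linear map. A Banach lattice $E$ has the disjoint weak$^{\star}$ Dunford-Pettis property if $\lim_{n\to\infty} f_n(x_n)=0$ for every norm bounded disjoint sequence $(x_n)$ in $E$ and every weak$^{\star}$ null sequence $(f_n)$ in the dual $E'$. An operator $T:E\to Y$ from a Banach lattice $E$ into a Banach space $Y$ is disjoint weak$^{\star}$ Dunford-Pettis if $\lim_{n\to\infty} f_n(Tx_n)=0$ for every norm bounded disjoint sequence $(x_n)$ in $E$ and every weak$^{\star}$ null sequence $(f_n)$ in $Y'$. A norm bounded subset $A$ of a Banach space $X$ is limited if every weak$^{\star}$ null sequence $(f_n)$ in $X'$ converges to $0$ uniformly on $A$, i.e. $\sup_{x\in A}|f_n(x)|\to0$. *)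

theory Defs
  imports "HOL-Analysis.Bounded_Linear_Function" "HOL-Analysis.Uniform_Limit"
    "HOL-Library.Lattice_Algebras"
begin

text \<open>A real Banach lattice: a Banach space that is a vector lattice under a lattice norm.
  The modulus is \<open>\<bar>x\<bar> = sup x (- x)\<close>, by the axiom of \<open>lattice_ab_group_add_abs\<close>.\<close>

class banach_lattice = banach + ordered_real_vector + lattice_ab_group_add_abs +
  assumes norm_mono_abs: "\<bar>x\<bar> \<le> \<bar>y\<bar> \<Longrightarrow> norm x \<le> norm y"

instance real :: banach_lattice
  by standard (auto simp: sup_real_def)

definition disjoint_seq :: "(nat \<Rightarrow> 'a::banach_lattice) \<Rightarrow> bool" where
  "disjoint_seq x \<longleftrightarrow> (\<forall>m n. m \<noteq> n \<longrightarrow> inf \<bar>x m\<bar> \<bar>x n\<bar> = 0)"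

definition weak_star_null :: "(nat \<Rightarrow> 'a::real_normed_vector \<Rightarrow>\<^sub>L real) \<Rightarrow> bool" where
  "weak_star_null f \<longleftrightarrow> (\<forall>x. (\<lambda>n. blinfun_apply (f n) x) \<longlonglongrightarrow> 0)"

definition disjoint_weak_star_DP_property :: "'a::banach_lattice itself \<Rightarrow> bool" where
  "disjoint_weak_star_DP_property (_ :: 'a itself) \<longleftrightarrow>
     (\<forall>(x :: nat \<Rightarrow> 'a) (f :: nat \<Rightarrow> 'a \<Rightarrow>\<^sub>L real).
        bounded (range x) \<longrightarrow> disjoint_seq x \<longrightarrow> weak_star_null f \<longrightarrow>
        (\<lambda>n. blinfun_apply (f n) (x n)) \<longlonglongrightarrow> 0)"

definition disjoint_weak_star_DP_operator ::
    "('a::banach_lattice \<Rightarrow>\<^sub>L 'b::banach) \<Rightarrow> bool" where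
  "disjoint_weak_star_DP_operator T \<longleftrightarrow>
     (\<forall>(x :: nat \<Rightarrow> 'a) (f :: nat \<Rightarrow> 'b \<Rightarrow>\<^sub>L real).
        bounded (range x) \<longrightarrow> disjoint_seq x \<longrightarrow> weak_star_null f \<longrightarrow>
        (\<lambda>n. blinfun_apply (f n) (blinfun_apply T (x n))) \<longlonglongrightarrow> 0)"

definition limited_set :: "'a::banach set \<Rightarrow> bool" where
  "limited_set A \<longleftrightarrow> bounded A \<and>
     (\<forall>f :: nat \<Rightarrow> 'a \<Rightarrow>\<^sub>L real. weak_star_null f \<longrightarrow>
        uniform_limit A (\<lambda>n. blinfun_apply (f n)) (\<lambda>_. 0) sequentially)"

end

theory Submission imports Defs begin

text \<open>The substantial implication is that the property makes the range of a bounded disjoint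
  sequence \<open>x\<close> limited. If \<open>f n\<close> does not converge to \<open>0\<close> uniformly on that range,
  then \<open>\<bar>f n (x k)\<bar> \<ge> e\<close> for arbitrarily large \<open>n\<close> and suitable \<open>k\<close>; pointwise
  convergence at the finitely many \<open>x 0, \<dots>, x K\<close> forces \<open>k > K\<close>, so both indices can be
  chosen strictly increasing. The resulting subsequences are again disjoint and weak\<open>\<^sup>*\<close> null
  and contradict the property.\<close>

lemma disjoint_seq_subseq:
  assumes "disjoint_seq x" "strict_mono k"
  shows "disjoint_seq (x \<circ> k)"
  using assms by (simp add: disjoint_seq_def strict_mono_eq)

lemma weak_star_null_subseq:
  assumes "weak_star_null f" "strict_mono r"
  shows "weak_star_null (f \<circ> r)"
  unfolding weak_star_null_def
proof
  fix y
  show "(\<lambda>n. blinfun_apply ((f \<circ> r) n) y) \<longlonglongrightarrow> 0"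
    using LIMSEQ_subseq_LIMSEQ[OF _ assms(2)] assms(1)
    by (fastforce simp: weak_star_null_def comp_def)
qed

lemma weak_star_null_compose:
  assumes "weak_star_null f"
  shows "weak_star_null (\<lambda>n. f n o\<^sub>L T)"
  using assms by (simp add: weak_star_null_def)

lemma disjoint_weak_star_DP_operator_id_iff:
  "disjoint_weak_star_DP_operator (id_blinfun :: 'a \<Rightarrow>\<^sub>L 'a) \<longleftrightarrow>
     disjoint_weak_star_DP_property TYPE('a::banach_lattice)"
  by (simp add: disjoint_weak_star_DP_operator_def disjoint_weak_star_DP_property_def)

text \<open>The images \<open>T (x n)\<close> need not be disjoint and may lie in a space without an
  order, so the property cannot be applied to them. Instead \<open>T\<close> is absorbed into the
  functionals: \<open>f n o\<^sub>L T\<close> is the adjoint of \<open>T\<close> applied to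
  \<open>f n\<close>, and \<open>x\<close> stays as it is.\<close>

lemma disjoint_weak_star_DP_property_operator:
  fixes T :: "'a::banach_lattice \<Rightarrow>\<^sub>L 'b::banach"
  assumes "disjoint_weak_star_DP_property TYPE('a)"
  shows "disjoint_weak_star_DP_operator T"
  unfolding disjoint_weak_star_DP_operator_def
proof (intro allI impI)
  fix x :: "nat \<Rightarrow> 'a" and f :: "nat \<Rightarrow> 'b \<Rightarrow>\<^sub>L real"
  assume "bounded (range x)" "disjoint_seq x" "weak_star_null f"
  with assms weak_star_null_compose
  have "(\<lambda>n. blinfun_apply (f n o\<^sub>L T) (x n)) \<longlonglongrightarrow> 0"
    unfolding disjoint_weak_star_DP_property_def by blast
  then show "(\<lambda>n. blinfun_apply (f n) (blinfun_apply T (x n))) \<longlonglongrightarrow> 0"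
    by simp
qed

text \<open>Strict growth is wanted for \<open>k\<close> as well as for \<open>r\<close>: a nonzero
  term is not disjoint from itself, so \<open>x \<circ> k\<close> must not repeat one.\<close>

lemma not_uniform_limit_range_subseqs:
  fixes f :: "nat \<Rightarrow> 'a \<Rightarrow> 'b::metric_space" and x :: "nat \<Rightarrow> 'a"
  assumes pointwise: "\<And>k. (\<lambda>n. f n (x k)) \<longlonglongrightarrow> l (x k)"
    and "\<not> uniform_limit (range x) f l sequentially"
  obtains e and r k :: "nat \<Rightarrow> nat" where "e > 0" "strict_mono r" "strict_mono k"
    "\<And>j. e \<le> dist (f (r j) (x (k j))) (l (x (k j)))"
proof -
  obtain e where "e > 0"
    and freq: "\<And>N. \<exists>n\<ge>N. \<exists>k. e \<le> dist (f n (x k)) (l (x k))"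
    using assms(2) unfolding uniform_limit_sequentially_iff by (fastforce simp: not_less)
  \<comment> \<open>Both indices are packed into one pair, so that a single dependent choice
    increases them together.\<close>
  define P where "P = (\<lambda>p. e \<le> dist (f (fst p) (x (snd p))) (l (x (snd p))))"
  have larger: "\<exists>p. P p \<and> N < fst p \<and> K < snd p" for N K
  proof -
    have "\<forall>\<^sub>F n in sequentially. \<forall>k\<in>{..K}. dist (f n (x k)) (l (x k)) < e"
      using pointwise \<open>e > 0\<close> by (intro eventually_ball_finite) (auto simp: tendsto_iff)
    then obtain M where M: "\<And>n k. \<lbrakk>M \<le> n; k \<le> K\<rbrakk> \<Longrightarrow> dist (f n (x k)) (l (x k)) < e"
      unfolding eventually_sequentially by auto
    \<comment> \<open>\<open>Suc N\<close> makes the first index exceed \<open>N\<close> strictly;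
      \<open>M\<close> rules out every k \<le> K, where the distance is already below
      \<open>e\<close>.\<close>
    obtain n k where "n \<ge> max (Suc N) M" and nk: "e \<le> dist (f n (x k)) (l (x k))"
      using freq by blast
    moreover from this M[of n k] have "K < k" by force
    ultimately show ?thesis by (intro exI[of _ "(n, k)"]) (simp add: P_def)
  qed
  have "\<exists>g. \<forall>j. P (g j) \<and> fst (g j) < fst (g (Suc j)) \<and> snd (g j) < snd (g (Suc j))"
    by (rule dependent_nat_choice[of "\<lambda>_. P" "\<lambda>_ p q. fst p < fst q \<and> snd p < snd q"])
      (use larger in blast)+
  then obtain g where g: "\<And>j. P (g j)"
    "\<And>j. fst (g j) < fst (g (Suc j))" "\<And>j. snd (g j) < snd (g (Suc j))"
    by blast
  show ?thesis
  proof (rule that[of e "fst \<circ> g" "snd \<circ> g"])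
    show "strict_mono (fst \<circ> g)" "strict_mono (snd \<circ> g)"
      using g by (simp_all add: strict_mono_Suc_iff)
    show "e \<le> dist (f ((fst \<circ> g) j) (x ((snd \<circ> g) j))) (l (x ((snd \<circ> g) j)))" for j
      using g(1)[of j] by (simp add: P_def)
  qed (fact \<open>e > 0\<close>)
qed

lemma disjoint_weak_star_DP_property_limited:
  fixes x :: "nat \<Rightarrow> 'a::banach_lattice"
  assumes DP: "disjoint_weak_star_DP_property TYPE('a)"
    and x: "bounded (range x)" "disjoint_seq x"
  shows "limited_set (range x)"
  unfolding limited_set_def
proof (intro conjI allI impI)
  fix f :: "nat \<Rightarrow> 'a \<Rightarrow>\<^sub>L real"
  assume f: "weak_star_null f"
  show "uniform_limit (range x) (\<lambda>n. blinfun_apply (f n)) (\<lambda>_. 0) sequentially"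
  proof (rule ccontr)
    assume not_unif: "\<not> ?thesis"
    have pointwise: "(\<lambda>n. f n (x k)) \<longlonglongrightarrow> 0" for k
      using f by (simp add: weak_star_null_def)
    show False
    proof (rule not_uniform_limit_range_subseqs[OF pointwise not_unif])
      fix e and r k :: "nat \<Rightarrow> nat"
      assume "e > 0" and rk: "strict_mono r" "strict_mono k"
        and ge: "\<And>j. e \<le> dist (f (r j) (x (k j))) 0"
      have "bounded (range (x \<circ> k))"
        using x(1) by (rule bounded_subset) auto
      then have "(\<lambda>j. (f \<circ> r) j ((x \<circ> k) j)) \<longlonglongrightarrow> 0"
        using DP disjoint_seq_subseq[OF x(2) rk(2)] weak_star_null_subseq[OF f rk(1)]
        unfolding disjoint_weak_star_DP_property_def by blast
      then obtain j where "dist (f (r j) (x (k j))) 0 < e"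
        using \<open>e > 0\<close> unfolding lim_sequentially comp_def by blast
      with ge[of j] show False by simp
    qed
  qed
qed (fact x(1))

lemma limited_disjoint_weak_star_DP_property:
  assumes "\<And>x :: nat \<Rightarrow> 'a::banach_lattice.
    \<lbrakk>bounded (range x); disjoint_seq x\<rbrakk> \<Longrightarrow> limited_set (range x)"
  shows "disjoint_weak_star_DP_property TYPE('a)"
  unfolding disjoint_weak_star_DP_property_def
proof (intro allI impI)
  fix x :: "nat \<Rightarrow> 'a" and f :: "nat \<Rightarrow> 'a \<Rightarrow>\<^sub>L real"
  assume "bounded (range x)" "disjoint_seq x" "weak_star_null f"
  then have "uniform_limit (range x) (\<lambda>n. blinfun_apply (f n)) (\<lambda>_. 0) sequentially"
    using assms unfolding limited_set_def by blast
  \<comment> \<open>The bound on \<open>f n\<close> is uniform over the range, so it may be read off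
    at a point \<open>x n\<close> that moves with \<open>n\<close>.\<close>
  then show "(\<lambda>n. blinfun_apply (f n) (x n)) \<longlonglongrightarrow> 0"
    unfolding uniform_limit_sequentially_iff lim_sequentially by blast
qed

theorem proposition3p7:
  shows "(disjoint_weak_star_DP_property TYPE('a::banach_lattice) \<longleftrightarrow>
            (\<forall>T :: 'a \<Rightarrow>\<^sub>L 'a. disjoint_weak_star_DP_operator T)) \<and>
         ((\<forall>T :: 'a \<Rightarrow>\<^sub>L 'a. disjoint_weak_star_DP_operator T) \<longleftrightarrow>
            disjoint_weak_star_DP_operator (id_blinfun :: 'a \<Rightarrow>\<^sub>L 'a)) \<and>
         (disjoint_weak_star_DP_operator (id_blinfun :: 'a \<Rightarrow>\<^sub>L 'a) \<longleftrightarrow>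
            (\<forall>x :: nat \<Rightarrow> 'a. bounded (range x) \<longrightarrow> disjoint_seq x \<longrightarrow>
               limited_set (range x)))"
  \<comment> \<open>The property passes to all operators, hence to the identity, and from there back
    to the property; the last two facts tie the property to limitedness.\<close>
  using disjoint_weak_star_DP_operator_id_iff[where 'a = 'a]
    disjoint_weak_star_DP_property_operator[where 'a = 'a and 'b = 'a]
    disjoint_weak_star_DP_property_limited[where 'a = 'a]
    limited_disjoint_weak_star_DP_property[where 'a = 'a]
  by blast

end
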